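(* Assume that $8\zeta(\sigma)\le\sqrt n$, $0<\sigma\le s_4^2$ and $\kappa\ge 3/2$. Then with probability at least $1-2\epsilon$, for any $i=1,\dots,d$, the two following inequalities hold together: \begin{align*} \bigl|\max\{\lambda_i,\sigma\}-\max\{\widehat\lambda_i,\sigma\}\bigr| &\le 2\max\{\lambda_i,\sigma\}B_*(\lambda_i)+5\delta\|G\|_F,\\ \bigl|\max\{\lambda_i,\sigma\}-\max\{\widehat\lambda_i,\sigma\}\bigr| &\le 2\max\{\widehat\lambda_i,\sigma\}B_*\bigl(\min\{\widehat\lambda_i,s_4^2\}\bigr)+5\delta\|G\|_F. \end{align*} Consequently, \begin{align*} |\lambda_i-\widehat\lambda_i| &\le 2\max\{\lambda_i,\sigma\}B_*(\lambda_i)+5\delta\|G\|_F+\sigma,\\ |\lambda_i-\widehat\lambda_i| &\le 2\max\{\widehat\lambda_i,\sigma\}B_*\bigl(\min\{\widehat\lambda_i,s_4^2\}\bigr)+5\delta\|G\|_F+\sigma. \end{align*}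
   Context: Let $X\in\mathbb R^d$ be a random vector with $\mathbb E\|X\|^4<\infty$, $X_1,\dots,X_n$ an i.i.d. sample with the law of $X$, and $G=\mathbb E(XX^\top)$ its Gram matrix. $\mathbb S_d=\{\theta\in\mathbb R^d:\|\theta\|=1\}$ and $\|M\|_F=\mathrm{Tr}(M^\top M)^{1/2}$. Fix $a>0$, $\delta>0$, $\epsilon\in(0,1)$ and a threshold $\sigma\in(0,s_4^2]$, where $s_4^2=\mathbb E(\|X\|^4)^{1/2}$. Put $$\kappa=\sup_{\theta\in\mathbb R^d,\ \mathbb E(\langle\theta,X\rangle^2)>0}\frac{\mathbb E(\langle\theta,X\rangle^4)}{\mathbb E(\langle\theta,X\rangle^2)^2},\qquad c=\frac{15}{8\log(2)(\sqrt2-1)}\exp\Bigl(\frac{1+2\sqrt2}{2}\Bigr),$$ $$K=1+\Bigl\lceil a^{-1}\log\Bigl(\frac{n}{72(2+c)\kappa^{1/2}}\Bigr)\Bigr\rceil,$$ $$\zeta(t)=\sqrt{2(\kappa-1)\Bigl(\frac{(2+3c)s_4^2}{4(2+c)\kappa^{1/2}t}+\log(K/\epsilon)\Bigr)}\cosh(a/4)+\sqrt{\frac{2(2+c)\kappa^{1/2}s_4^2}{t}}\cosh(a/2),$$ $$B_*(t)=\begin{cases}\dfrac{n^{-1/2}\zeta(\max\{t,\sigma\})}{1-4n^{-1/2}\zeta(\max\{t,\sigma\})} & \text{if }[6+(\kappa-1)^{-1}]\,\zeta(\max\{t,\sigma\})\le\sqrt n,\\ +\infty&\text{otherwise.}\end{cases}$$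 Estimator. $Q$ is a random symmetric $d\times d$ matrix (a function of the sample), $Q=Q_+-Q_-$ is its decomposition into positive and negative parts, and $\widehat G=Q_+$. The estimator $Q$ has the following property (when $8\zeta(\sigma)\le\sqrt n$, $\sigma\le s_4^2$, $\kappa\ge3/2$): there is an event of probability at least $1-2\epsilon$ on which, for every $\theta\in\mathbb S_d$, $\bigl|\max\{\theta^\top Q\theta,\sigma\}-\max\{\theta^\top G\theta,\sigma\}\bigr|$ is at most each of $$2\max\{\theta^\top G\theta,\sigma\}B_*(\theta^\top G\theta)+5\delta\|G\|_F,\qquad 2\max\{\theta^\top Q\theta,\sigma\}B_*(\min\{\theta^\top Q\theta,s_4^2\})+5\delta\|G\|_F,$$ and $\bigl|\max\{\theta^\top\widehat G\theta,\sigma\}-\max\{\theta^\top G\theta,\sigma\}\bigr|$ is at most each of $$2\max\{\theta^\top G\theta,\sigma\}B_*(\theta^\top G\theta)+7\delta\|G\|_F,\qquad 2\max\{\theta^\top\widehat G\theta,\sigma\}B_*(\min\{\theta^\top\widehat G\theta,s_4^2\})+7\delta\|G\|_F.$$ $\lambda_1\ge\dots\ge\lambda_d$ are the eigenvalues of $G$ and $\widehat\lambda_1\ge\dots\ge\widehat\lambda_d$ those of $\widehat G$. *)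

theory Defs
  imports "HOL-Probability.Probability"
begin

definition gram :: "'w measure \<Rightarrow> ('w \<Rightarrow> real ^ 'd) \<Rightarrow> real ^ 'd ^ 'd" where
  "gram M X = (\<integral>\<omega>. (\<chi> i j. X \<omega> $ i * X \<omega> $ j) \<partial>M)"

definition frobenius_norm :: "real ^ 'd ^ 'd \<Rightarrow> real" where
  "frobenius_norm A = sqrt (trace (transpose A ** A))"

definition quad_form :: "real ^ 'd ^ 'd \<Rightarrow> real ^ 'd \<Rightarrow> real" where
  "quad_form A \<theta> = \<theta> \<bullet> (A *v \<theta>)"

definition symmetric_matrix :: "real ^ 'd ^ 'd \<Rightarrow> bool" where
  "symmetric_matrix A \<longleftrightarrow> transpose A = A"

definition pos_semidef :: "real ^ 'd ^ 'd \<Rightarrow> bool" where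
  "pos_semidef A \<longleftrightarrow> symmetric_matrix A \<and> (\<forall>\<theta>. 0 \<le> quad_form A \<theta>)"

text \<open>The conditions below determine the positive part \<open>P\<close> and the negative part \<open>N\<close> of a
  symmetric matrix \<open>A\<close> uniquely.\<close>

definition pos_neg_parts :: "real ^ 'd ^ 'd \<Rightarrow> real ^ 'd ^ 'd \<Rightarrow> real ^ 'd ^ 'd \<Rightarrow> bool" where
  "pos_neg_parts A P N \<longleftrightarrow> A = P - N \<and> pos_semidef P \<and> pos_semidef N \<and> P ** N = 0"

definition eigenspace :: "real ^ 'd ^ 'd \<Rightarrow> real \<Rightarrow> (real ^ 'd) set" where
  "eigenspace A c = {v. A *v v = c *\<^sub>R v}"

text \<open>Each eigenvalue is repeated according to the dimension of its eigenspace. The index set of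
  the sum is finite for every \<open>A\<close>; for symmetric \<open>A\<close> the multiset has \<open>CARD('d)\<close> elements.\<close>

definition eigenvalue_mset :: "real ^ 'd ^ 'd \<Rightarrow> real multiset" where
  "eigenvalue_mset A =
     (\<Sum>c\<in>{c. eigenspace A c \<noteq> {0}}. replicate_mset (dim (eigenspace A c)) c)"

text \<open>The \<open>i\<close>-th largest eigenvalue of a symmetric matrix, for \<open>i\<close> in \<open>{1..CARD('d)}\<close>.\<close>

definition eigval :: "real ^ 'd ^ 'd \<Rightarrow> nat \<Rightarrow> real" where
  "eigval A i = rev (sorted_list_of_multiset (eigenvalue_mset A)) ! (i - 1)"

text \<open>\<open>s4_sq M X\<close> is the square of the quantity usually written \<open>s_4\<close>.\<close>

definition s4_sq :: "'w measure \<Rightarrow> ('w \<Rightarrow> real ^ 'd) \<Rightarrow> real" where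
  "s4_sq M X = sqrt (\<integral>\<omega>. norm (X \<omega>) ^ 4 \<partial>M)"

text \<open>If the fourth moment of \<open>X\<close> is finite, the ratios are bounded, because \<open>\<theta>\<close> may be restricted
  to the unit sphere of the range of the Gram matrix. So the supremum may be taken in the reals.
  The set of ratios is empty only if \<open>X = 0\<close> almost surely, that is, if \<open>s4_sq M X = 0\<close>.\<close>

definition kurtosis :: "'w measure \<Rightarrow> ('w \<Rightarrow> real ^ 'd) \<Rightarrow> real" where
  "kurtosis M X =
     (SUP \<theta>\<in>{\<theta>. (\<integral>\<omega>. (\<theta> \<bullet> X \<omega>) ^ 2 \<partial>M) > 0}.
        (\<integral>\<omega>. (\<theta> \<bullet> X \<omega>) ^ 4 \<partial>M) / (\<integral>\<omega>. (\<theta> \<bullet> X \<omega>) ^ 2 \<partial>M) ^ 2)"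

definition c_const :: real where
  "c_const = 15 / (8 * ln 2 * (sqrt 2 - 1)) * exp ((1 + 2 * sqrt 2) / 2)"

definition K_const :: "nat \<Rightarrow> real \<Rightarrow> real \<Rightarrow> int" where
  "K_const n a \<kappa> = 1 + \<lceil>ln (real n / (72 * (2 + c_const) * sqrt \<kappa>)) / a\<rceil>"

text \<open>In the next two definitions the parameter \<open>s\<close> stands for \<open>s4_sq M X\<close>.\<close>

definition zeta :: "nat \<Rightarrow> real \<Rightarrow> real \<Rightarrow> real \<Rightarrow> real \<Rightarrow> real \<Rightarrow> real" where
  "zeta n a \<epsilon> \<kappa> s t =
     sqrt (2 * (\<kappa> - 1) *
       ((2 + 3 * c_const) * s / (4 * (2 + c_const) * sqrt \<kappa> * t)
         + ln (of_int (K_const n a \<kappa>) / \<epsilon>))) * cosh (a / 4)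
     + sqrt (2 * (2 + c_const) * sqrt \<kappa> * s / t) * cosh (a / 2)"

definition B_star :: "nat \<Rightarrow> real \<Rightarrow> real \<Rightarrow> real \<Rightarrow> real \<Rightarrow> real \<Rightarrow> real \<Rightarrow> ereal" where
  "B_star n a \<epsilon> \<kappa> s \<sigma> t =
     (if (6 + 1 / (\<kappa> - 1)) * zeta n a \<epsilon> \<kappa> s (max t \<sigma>) \<le> sqrt (real n)
      then ereal ((zeta n a \<epsilon> \<kappa> s (max t \<sigma>) / sqrt (real n))
                  / (1 - 4 * (zeta n a \<epsilon> \<kappa> s (max t \<sigma>) / sqrt (real n))))
      else \<infinity>)"

end

theory Submission
  imports Defs
begin

text \<open>By the min-max principle, each \<open>i\<close> admits a unit vector with
  \<open>\<theta>\<^sup>T G \<theta> \<le> \<lambda>\<^sub>i\<close> that tests at least the thresholded \<open>i\<close>-th eigenvalue of the estimator,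
  and another one with both inequalities reversed: a span of \<open>i\<close> top eigenvectors of one matrix
  meets a span of \<open>d - i + 1\<close> bottom eigenvectors of the other. The deviation bounds at these two
  vectors transfer to the eigenvalues because \<open>t (1 + 2 B(t))\<close> and \<open>t (1 - 2 B(t))\<close> are
  nondecreasing for \<open>t \<ge> \<sigma>\<close>, where the assumption \<open>8 \<zeta>(\<sigma>) \<le> \<surd>n\<close> keeps \<open>B\<close> finite and
  at most \<open>1/4\<close>.\<close>

section \<open>The spectral theorem for symmetric matrices\<close>

lemma symmetric_matrix_inner:
  assumes "symmetric_matrix A"
  shows "x \<bullet> (A *v y) = (A *v x) \<bullet> y"
proof -
  have "A *v x = x v* A"
    using assms transpose_matrix_vector[of A x] by (simp add: symmetric_matrix_def)
  then show ?thesis by (simp add: dot_lmul_matrix)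
qed

lemma quad_form_add_scaleR:
  assumes "symmetric_matrix A"
  shows "quad_form A (x + t *\<^sub>R y)
    = quad_form A x + 2 * t * (y \<bullet> (A *v x)) + t\<^sup>2 * quad_form A y"
proof -
  have "x \<bullet> (A *v y) = y \<bullet> (A *v x)"
    using symmetric_matrix_inner[OF assms] by (simp add: inner_commute)
  then show ?thesis
    by (simp add: quad_form_def matrix_vector_right_distrib matrix_vector_mult_scaleR
        inner_add_left inner_add_right power2_eq_square algebra_simps)
qed

text \<open>Near \<open>t = 0\<close> the linear term dominates, so a nonzero \<open>b\<close> would
  make the expression negative at a small \<open>t\<close> of opposite sign. This serves as the
  first-order condition at a maximum of a quadratic form.\<close>

lemma quadratic_nonneg_imp_linear_coeff_0:
  fixes b h :: real
  assumes "\<And>t. 0 \<le> 2 * t * b + t\<^sup>2 * h"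
  shows "b = 0"
proof (rule ccontr)
  assume "b \<noteq> 0"
  \<comment> \<open>Any positive \<open>k\<close> above \<open>h\<close> makes
    \<open>h / k - 2\<close> negative at the test value \<open>t = - b / k\<close>.\<close>
  define k where "k = \<bar>h\<bar> + 1"
  have k: "k > 0" "h < k" by (auto simp: k_def)
  have "0 \<le> 2 * (- b / k) * b + (- b / k)\<^sup>2 * h" by (rule assms)
  also have "\<dots> = (b\<^sup>2 / k) * (h / k - 2)"
    using k by (simp add: field_simps power2_eq_square)
  also have "\<dots> < 0"
    using k \<open>b \<noteq> 0\<close> by (intro mult_pos_neg) (auto simp: field_simps)
  finally show False by simp
qed

text \<open>A maximiser \<open>u\<close> of the form on the unit sphere of \<open>W\<close> is
  critical, so the residual \<open>c *\<^sub>R u - A *v u\<close> is orthogonal to \<open>W\<close>.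
  By invariance the residual lies in \<open>W\<close>, hence it is orthogonal to itself.\<close>

lemma symmetric_invariant_subspace_eigenvector:
  fixes A :: "real ^ 'd ^ 'd"
  assumes A: "symmetric_matrix A" and W: "subspace W"
    and inv: "\<And>w. w \<in> W \<Longrightarrow> A *v w \<in> W" and ne: "W \<noteq> {0}"
  obtains u c where "u \<in> W" "norm u = 1" "A *v u = c *\<^sub>R u"
proof -
  obtain w where w: "w \<in> W" "w \<noteq> 0" using ne subspace_0[OF W] by blast
  have "compact (W \<inter> sphere 0 1)"
    by (simp add: W closed_Int_compact closed_subspace)
  moreover have "(1 / norm w) *\<^sub>R w \<in> W \<inter> sphere 0 1"
    using w W by (simp add: subspace_scale)
  moreover have "continuous_on (W \<inter> sphere 0 1) (quad_form A)"
    unfolding quad_form_def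
    by (rule continuous_on_inner[OF continuous_on_id
          linear_continuous_on[OF matrix_vector_mul_bounded_linear]])
  ultimately obtain u where u: "u \<in> W" "norm u = 1"
    and max: "\<And>v. v \<in> W \<inter> sphere 0 1 \<Longrightarrow> quad_form A v \<le> quad_form A u"
    using continuous_attains_sup[of "W \<inter> sphere 0 1" "quad_form A"]
    by (metis IntE emptyE mem_sphere_0)
  define c where "c = quad_form A u"
  \<comment> \<open>Homogeneity extends the maximality of \<open>u\<close> from the unit sphere to
    all of \<open>W\<close>.\<close>
  have le: "quad_form A v \<le> c * (v \<bullet> v)" if "v \<in> W" for v
  proof (cases "v = 0")
    case False
    have "quad_form A ((1 / norm v) *\<^sub>R v) \<le> c"
      unfolding c_def using that False W by (intro max) (simp add: subspace_scale)
    then show ?thesis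
      using False by (simp add: quad_form_def matrix_vector_mult_scaleR field_simps
          dot_square_norm power2_eq_square)
  qed (simp add: quad_form_def)
  \<comment> \<open>The polynomial in \<open>t\<close> is the slack of \<open>le\<close> at
    \<open>u + t *\<^sub>R v\<close>; its constant term vanishes because \<open>le\<close> is an
    equality at \<open>u\<close>.\<close>
  have "v \<bullet> (c *\<^sub>R u - A *v u) = 0" if v: "v \<in> W" for v
  proof (rule quadratic_nonneg_imp_linear_coeff_0)
    fix t :: real
    have "quad_form A (u + t *\<^sub>R v) \<le> c * ((u + t *\<^sub>R v) \<bullet> (u + t *\<^sub>R v))"
      using u v W by (intro le) (simp add: subspace_add subspace_scale)
    moreover have "u \<bullet> u = 1" using u by (simp add: dot_square_norm)
    ultimately show "0 \<le> 2 * t * (v \<bullet> (c *\<^sub>R u - A *v u)) + t\<^sup>2 * (c * (v \<bullet> v) - quad_form A v)"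
      by (simp add: quad_form_add_scaleR[OF A] c_def[symmetric] inner_add_left inner_add_right
          inner_diff_right inner_commute power2_eq_square algebra_simps)
  qed
  moreover have "c *\<^sub>R u - A *v u \<in> W"
    using u W inv by (simp add: subspace_diff subspace_scale)
  ultimately have "(c *\<^sub>R u - A *v u) \<bullet> (c *\<^sub>R u - A *v u) = 0" by blast
  then have "A *v u = c *\<^sub>R u" by simp
  then show thesis using that u by blast
qed

lemma orthonormal_imp_independent:
  assumes "pairwise orthogonal B" "\<And>v. v \<in> B \<Longrightarrow> norm v = 1"
  shows "independent B"
  using assms by (intro pairwise_orthogonal_independent) fastforce+

text \<open>Among the orthonormal sets of eigenvectors take one of greatest size. Its orthogonal
  complement is invariant because \<open>A\<close> is symmetric, so a nonzero complement would
  supply one more eigenvector.\<close>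

lemma symmetric_orthonormal_eigenbasis:
  fixes A :: "real ^ 'd ^ 'd"
  assumes A: "symmetric_matrix A"
  obtains B e where "pairwise orthogonal B" "\<And>v. v \<in> B \<Longrightarrow> norm v = 1"
    "\<And>v. v \<in> B \<Longrightarrow> A *v v = e v *\<^sub>R v" "finite B" "card B = CARD('d)" "span B = UNIV"
proof -
  define P where "P B \<longleftrightarrow> pairwise orthogonal B \<and> (\<forall>v\<in>B. norm v = 1 \<and> (\<exists>c. A *v v = c *\<^sub>R v))"
    for B :: "(real ^ 'd) set"
  have indep: "independent B" if "P B" for B
    using that by (intro orthonormal_imp_independent) (auto simp: P_def)
  have "P {}" by (simp add: P_def)
  moreover have "card B < Suc CARD('d)" if "P B" for B
    using independent_bound[OF indep[OF that]] by simp
  then have "\<forall>B. P B \<longrightarrow> card B < Suc CARD('d)" by blast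
  ultimately have "\<exists>B. P B \<and> (\<forall>B'. P B' \<longrightarrow> card B' \<le> card B)"
    by (rule ex_has_greatest_nat)
  then obtain B where B: "P B" and max: "\<And>B'. P B' \<Longrightarrow> card B' \<le> card B"
    by blast
  have fin: "finite B" using indep[OF B] by (rule independent_imp_finite)
  define W where "W = {x. \<forall>v\<in>B. v \<bullet> x = 0}"
  have "W = {0}"
  proof (rule ccontr)
    assume ne: "W \<noteq> {0}"
    have "subspace W" by (auto simp: W_def subspace_def inner_add_right)
    moreover have "A *v w \<in> W" if "w \<in> W" for w
    proof -
      have "v \<bullet> (A *v w) = 0" if v: "v \<in> B" for v
      proof -
        obtain c where "A *v v = c *\<^sub>R v" using B v by (auto simp: P_def)
        moreover have "v \<bullet> w = 0" using v \<open>w \<in> W\<close> by (simp add: W_def)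
        ultimately show ?thesis by (simp add: symmetric_matrix_inner[OF A])
      qed
      then show ?thesis by (simp add: W_def)
    qed
    ultimately obtain u c where u: "u \<in> W" "norm u = 1" "A *v u = c *\<^sub>R u"
      by (rule symmetric_invariant_subspace_eigenvector[OF A _ _ ne])
    have "u \<notin> B" using u by (auto simp: W_def)
    have "P (insert u B)"
      using B u by (auto simp: P_def W_def pairwise_insert orthogonal_def inner_commute)
    from max[OF this] show False using \<open>u \<notin> B\<close> fin by simp
  qed
  have "span B = UNIV"
  proof (rule ccontr)
    assume "span B \<noteq> UNIV"
    then have "span B \<subset> span UNIV" by auto
    then obtain x where "x \<noteq> 0" "\<And>y. y \<in> span B \<Longrightarrow> orthogonal x y"
      using orthogonal_to_subspace_exists_gen by blast
    then have "x \<in> W" "x \<noteq> 0"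
      by (auto simp: W_def orthogonal_def inner_commute span_base)
    then show False using \<open>W = {0}\<close> by simp
  qed
  moreover have "card B = CARD('d)"
    using dim_span_eq_card_independent[OF indep[OF B]] \<open>span B = UNIV\<close> by simp
  moreover have "\<forall>v\<in>B. \<exists>c. A *v v = c *\<^sub>R v" using B by (simp add: P_def)
  then obtain e where "\<forall>v\<in>B. A *v v = e v *\<^sub>R v" by metis
  ultimately show thesis using that[of B e] B fin by (auto simp: P_def)
qed

text \<open>Eigenvectors of a symmetric matrix for distinct eigenvalues are orthogonal, so expanding
  an element of the eigenspace in \<open>B\<close> leaves only the terms with
  \<open>e v = c\<close>.\<close>

lemma eigenspace_eq_span:
  fixes A :: "real ^ 'd ^ 'd"
  assumes A: "symmetric_matrix A"
    and B: "pairwise orthogonal B" "\<And>v. v \<in> B \<Longrightarrow> norm v = 1"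
    and e: "\<And>v. v \<in> B \<Longrightarrow> A *v v = e v *\<^sub>R v" and fin: "finite B" and span: "span B = UNIV"
  shows "eigenspace A c = span {v \<in> B. e v = c}"
proof
  have "subspace (eigenspace A c)"
    by (auto simp: subspace_def eigenspace_def matrix_vector_right_distrib
        matrix_vector_mult_scaleR algebra_simps)
  then show "span {v \<in> B. e v = c} \<subseteq> eigenspace A c"
    by (rule span_minimal[rotated]) (auto simp: eigenspace_def e)
  show "eigenspace A c \<subseteq> span {v \<in> B. e v = c}"
  proof
    fix x assume x: "x \<in> eigenspace A c"
    have zero: "x \<bullet> v = 0" if "v \<in> B" "e v \<noteq> c" for v
    proof -
      have "x \<bullet> (A *v v) = (A *v x) \<bullet> v" by (rule symmetric_matrix_inner[OF A])
      then have "e v * (x \<bullet> v) = c * (x \<bullet> v)"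
        using x that by (simp add: eigenspace_def e)
      then show ?thesis using that by simp
    qed
    have "x = (\<Sum>v\<in>B. (x \<bullet> v) *\<^sub>R v)"
      by (rule orthonormal_basis_expand[symmetric]) (use B fin span in auto)
    also have "\<dots> = (\<Sum>v\<in>{v\<in>B. e v = c}. (x \<bullet> v) *\<^sub>R v)"
      by (rule sum.mono_neutral_right) (use fin zero in auto)
    finally show "x \<in> span {v \<in> B. e v = c}"
      using span_sum[of "{v\<in>B. e v = c}" "\<lambda>v. (x \<bullet> v) *\<^sub>R v"]
      by (metis (no_types, lifting) span_base span_scale)
  qed
qed

text \<open>The dimension of an eigenspace counts the basis vectors with that eigenvalue. This lets
  the multiset, defined without a basis, be read off from any orthonormal eigenbasis.\<close>

lemma eigenvalue_mset_eq_image_mset: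
  fixes A :: "real ^ 'd ^ 'd"
  assumes A: "symmetric_matrix A"
    and B: "pairwise orthogonal B" "\<And>v. v \<in> B \<Longrightarrow> norm v = 1"
    and e: "\<And>v. v \<in> B \<Longrightarrow> A *v v = e v *\<^sub>R v" and fin: "finite B" and span: "span B = UNIV"
  shows "eigenvalue_mset A = image_mset e (mset_set B)"
proof (rule multiset_eqI)
  fix c
  have indep: "independent {v \<in> B. e v = c}" for c
    using B by (intro orthonormal_imp_independent) (auto simp: pairwise_def)
  have es: "eigenspace A c = span {v \<in> B. e v = c}" for c
    by (rule eigenspace_eq_span) (use assms in auto)
  have dim: "dim (eigenspace A c) = card {v \<in> B. e v = c}" for c
    unfolding es by (rule dim_span_eq_card_independent[OF indep])
  \<comment> \<open>This turns the index set of the sum in \<open>eigenvalue_mset\<close> into the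
    image of \<open>B\<close> under \<open>e\<close>.\<close>
  have ne: "eigenspace A c \<noteq> {0} \<longleftrightarrow> c \<in> e ` B" for c
  proof -
    have "eigenspace A c = {0} \<longleftrightarrow> dim (eigenspace A c) = 0"
      unfolding es using span_0[of "{v \<in> B. e v = c}"] by (subst dim_eq_0) blast
    then show ?thesis using fin by (auto simp: dim)
  qed
  have "count (eigenvalue_mset A) c
      = (\<Sum>x\<in>e ` B. if x = c then card {v \<in> B. e v = c} else 0)"
    by (auto simp: eigenvalue_mset_def ne count_sum dim intro!: sum.cong)
  also have "\<dots> = card {v \<in> B. e v = c}"
    using fin by (auto simp: sum.delta' card_eq_0_iff)
  also have "\<dots> = count (image_mset e (mset_set B)) c"
    using fin by (auto simp: count_image_mset' eq_commute intro!: arg_cong[of _ _ card])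
  finally show "count (eigenvalue_mset A) c = count (image_mset e (mset_set B)) c" .
qed

text \<open>Listing an eigenbasis by decreasing eigenvalue reproduces the list from which
  \<open>eigval\<close> reads, so basis vectors and eigenvalues receive the same numbering.\<close>

lemma symmetric_eigval_basis:
  fixes A :: "real ^ 'd ^ 'd"
  assumes A: "symmetric_matrix A"
  obtains p where "inj_on p {1..CARD('d)}" "pairwise orthogonal (p ` {1..CARD('d)})"
    "\<And>i. i \<in> {1..CARD('d)} \<Longrightarrow> norm (p i) = 1"
    "\<And>i. i \<in> {1..CARD('d)} \<Longrightarrow> A *v p i = eigval A i *\<^sub>R p i"
    "\<And>i j. \<lbrakk>i \<in> {1..CARD('d)}; j \<in> {1..CARD('d)}; i \<le> j\<rbrakk> \<Longrightarrow> eigval A j \<le> eigval A i"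
proof -
  obtain B e where B: "pairwise orthogonal B" "\<And>v. v \<in> B \<Longrightarrow> norm v = 1"
    "\<And>v. v \<in> B \<Longrightarrow> A *v v = e v *\<^sub>R v" "finite B" "card B = CARD('d)" "span B = UNIV"
    using symmetric_orthonormal_eigenbasis[OF A] by metis
  obtain xs where xs: "set xs = B" "distinct xs"
    using finite_distinct_list[OF B(4)] by blast
  define vs where "vs = rev (sort_key e xs)"
  have vs: "set vs = B" "distinct vs" "length vs = CARD('d)"
    using xs B(5) distinct_card[OF xs(2)] by (auto simp: vs_def)
  have "eigenvalue_mset A = mset (map e (sort_key e xs))"
    using eigenvalue_mset_eq_image_mset[OF A B(1-4) B(6)] xs
    by (simp add: mset_set_set[symmetric])
  then have "sorted_list_of_multiset (eigenvalue_mset A) = sort (map e (sort_key e xs))"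
    by (simp only: sorted_list_of_multiset_mset)
  also have "\<dots> = map e (sort_key e xs)"
    by (rule sort_key_id_if_sorted) simp
  finally have list: "rev (sorted_list_of_multiset (eigenvalue_mset A)) = map e vs"
    by (simp add: vs_def rev_map)
  \<comment> \<open>Eigenvalues are numbered from 1, list positions from 0.\<close>
  define p where "p i = vs ! (i - 1)" for i
  have eig: "eigval A i = e (p i)" if "i \<in> {1..CARD('d)}" for i
    using that vs by (auto simp: eigval_def list p_def intro!: nth_map)
  have pB: "p i \<in> B" if "i \<in> {1..CARD('d)}" for i
    using that vs nth_mem[of "i - 1" vs] by (auto simp: p_def)
  have "inj_on p {1..CARD('d)}"
    using vs by (auto simp: inj_on_def p_def nth_eq_iff_index_eq)
  moreover have "pairwise orthogonal (p ` {1..CARD('d)})"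
    using B(1) by (rule pairwise_subset) (use pB in auto)
  moreover have "eigval A j \<le> eigval A i"
    if ij: "i \<in> {1..CARD('d)}" "j \<in> {1..CARD('d)}" "i \<le> j" for i j
  proof -
    have "sorted_wrt (\<ge>) (map e vs)"
      by (simp add: vs_def rev_map[symmetric] sorted_wrt_rev)
    then show ?thesis
      using ij vs sorted_wrt_nth_less[of "(\<ge>)" "map e vs" "i - 1" "j - 1"]
      by (cases "i = j") (auto simp: eig p_def)
  qed
  ultimately show thesis using that[of p] pB B eig by metis
qed

section \<open>Comparison of eigenvalues by the min-max principle\<close>

lemma quad_form_eigenvector:
  assumes "norm v = 1" "A *v v = c *\<^sub>R v"
  shows "quad_form A v = c"
  using assms by (simp add: quad_form_def dot_square_norm)

text \<open>The form at a unit vector of the span is an average of eigenvalues with weights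
  \<open>(x \<bullet> v)\<^sup>2\<close>. The eigenvalue of \<open>v\<close> is written
  \<open>quad_form A v\<close>, with which it agrees for unit eigenvectors.\<close>

lemma quad_form_span_eigenvectors:
  fixes A :: "real ^ 'd ^ 'd"
  assumes S: "finite S" "pairwise orthogonal S" "\<And>v. v \<in> S \<Longrightarrow> norm v = 1"
    and eig: "\<And>v. v \<in> S \<Longrightarrow> A *v v = quad_form A v *\<^sub>R v"
    and x: "x \<in> span S" "norm x = 1"
  shows "quad_form A x = (\<Sum>v\<in>S. quad_form A v * (x \<bullet> v)\<^sup>2)" "(\<Sum>v\<in>S. (x \<bullet> v)\<^sup>2) = 1"
proof -
  have expand: "x = (\<Sum>v\<in>S. (x \<bullet> v) *\<^sub>R v)"
    by (rule orthonormal_basis_expand[symmetric]) (use S x in auto)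
  have "A *v x = (\<Sum>v\<in>S. (x \<bullet> v) *\<^sub>R (A *v v))"
    by (subst expand) (simp add: linear_sum[OF matrix_vector_mul_linear] matrix_vector_mult_scaleR)
  also have "\<dots> = (\<Sum>v\<in>S. (quad_form A v * (x \<bullet> v)) *\<^sub>R v)"
    by (rule sum.cong) (auto simp: eig)
  finally have "x \<bullet> (A *v x) = (\<Sum>v\<in>S. quad_form A v * (x \<bullet> v)\<^sup>2)"
    by (simp add: inner_sum_right power2_eq_square mult.assoc)
  then show "quad_form A x = (\<Sum>v\<in>S. quad_form A v * (x \<bullet> v)\<^sup>2)"
    by (simp only: quad_form_def)
  have "x \<bullet> x = (\<Sum>v\<in>S. (x \<bullet> v)\<^sup>2)"
    by (subst (2) expand) (simp add: inner_sum_right power2_eq_square)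
  then show "(\<Sum>v\<in>S. (x \<bullet> v)\<^sup>2) = 1" using x by (simp add: dot_square_norm)
qed

lemma quad_form_span_bounds:
  fixes A :: "real ^ 'd ^ 'd"
  assumes S: "finite S" "pairwise orthogonal S" "\<And>v. v \<in> S \<Longrightarrow> norm v = 1"
    and eig: "\<And>v. v \<in> S \<Longrightarrow> A *v v = quad_form A v *\<^sub>R v"
    and x: "x \<in> span S" "norm x = 1"
  shows "(\<And>v. v \<in> S \<Longrightarrow> c \<le> quad_form A v) \<Longrightarrow> c \<le> quad_form A x"
    and "(\<And>v. v \<in> S \<Longrightarrow> quad_form A v \<le> c) \<Longrightarrow> quad_form A x \<le> c"
proof -
  note eq = quad_form_span_eigenvectors[OF assms]
  have c: "(\<Sum>v\<in>S. c * (x \<bullet> v)\<^sup>2) = c" by (simp add: sum_distrib_left[symmetric] eq(2))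
  show "c \<le> quad_form A x" if "\<And>v. v \<in> S \<Longrightarrow> c \<le> quad_form A v"
  proof -
    have "(\<Sum>v\<in>S. c * (x \<bullet> v)\<^sup>2) \<le> (\<Sum>v\<in>S. quad_form A v * (x \<bullet> v)\<^sup>2)"
      by (intro sum_mono mult_right_mono that) auto
    then show ?thesis by (simp only: c eq(1))
  qed
  show "quad_form A x \<le> c" if "\<And>v. v \<in> S \<Longrightarrow> quad_form A v \<le> c"
  proof -
    have "(\<Sum>v\<in>S. quad_form A v * (x \<bullet> v)\<^sup>2) \<le> (\<Sum>v\<in>S. c * (x \<bullet> v)\<^sup>2)"
      by (intro sum_mono mult_right_mono that) auto
    then show ?thesis by (simp only: c eq(1))
  qed
qed

text \<open>The sum of the two spans has at most the dimension of the space, so the dimension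
  formula leaves a positive dimension for their intersection.\<close>

lemma spans_share_unit_vector:
  fixes S T :: "'a::euclidean_space set"
  assumes "independent S" "independent T" "DIM('a) < card S + card T"
  obtains x where "x \<in> span S" "x \<in> span T" "norm x = 1"
proof -
  have "dim {x + y |x y. x \<in> span S \<and> y \<in> span T} + dim (span S \<inter> span T) = card S + card T"
    using dim_sums_Int[of "span S" "span T"] assms(1,2) by (simp add: dim_eq_card_independent)
  moreover have "dim {x + y |x y. x \<in> span S \<and> y \<in> span T} \<le> DIM('a)" by (rule dim_subset_UNIV)
  ultimately have "dim (span S \<inter> span T) \<noteq> 0" using assms(3) by linarith
  then obtain y where "y \<in> span S" "y \<in> span T" "y \<noteq> 0" by auto
  then show thesis by (intro that[of "(1 / norm y) *\<^sub>R y"]) (auto simp: span_scale)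
qed

lemma pos_neg_parts_quad_form_le:
  assumes "pos_neg_parts Q P N"
  shows "quad_form Q x \<le> quad_form P x"
proof -
  have "quad_form Q x = quad_form P x - quad_form N x"
    using assms by (simp add: pos_neg_parts_def quad_form_def matrix_vector_mult_diff_rdistrib
        inner_diff_right)
  then show ?thesis using assms by (simp add: pos_neg_parts_def pos_semidef_def)
qed

text \<open>By symmetry, transposing \<open>P ** N = 0\<close> gives \<open>N ** P = 0\<close>.
  Applying \<open>N\<close> to the eigenvalue equation then yields zero, and \<open>c\<close>
  cancels.\<close>

lemma neg_part_annihilates_pos_eigenvector:
  assumes "pos_neg_parts Q P N" and v: "P *v v = c *\<^sub>R v" "c \<noteq> 0"
  shows "N *v v = 0"
proof -
  have "transpose P = P" "transpose N = N" "P ** N = 0"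
    using assms(1) by (auto simp: pos_neg_parts_def pos_semidef_def symmetric_matrix_def)
  then have "N ** P = 0"
    using matrix_transpose_mul[of P N] by (simp add: transpose_def zero_vec_def)
  then have "c *\<^sub>R (N *v v) = 0"
    using v(1) by (metis matrix_vector_mul_assoc matrix_vector_mult_0 matrix_vector_mult_scaleR)
  then show ?thesis using v(2) by simp
qed

text \<open>A sorted eigenbasis is cut at \<open>i\<close>, with the \<open>i\<close>-th vector put
  on both sides, so the two sizes exceed the dimension by one in total. The last clause keeps the
  eigenvectors at hand for showing that a negative part vanishes on the span of
  \<open>S\<close>.\<close>

lemma eigval_subspaces:
  fixes A :: "real ^ 'd ^ 'd"
  assumes A: "symmetric_matrix A" and i: "i \<in> {1..CARD('d)}"
  obtains S T where "independent S" "card S = i" "independent T" "card T = Suc CARD('d) - i"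
    "\<forall>x\<in>span S. norm x = 1 \<longrightarrow> eigval A i \<le> quad_form A x"
    "\<forall>x\<in>span T. norm x = 1 \<longrightarrow> quad_form A x \<le> eigval A i"
    "\<forall>v\<in>S. \<exists>c\<ge>eigval A i. A *v v = c *\<^sub>R v"
proof -
  obtain p where inj: "inj_on p {1..CARD('d)}" and orth: "pairwise orthogonal (p ` {1..CARD('d)})"
    and norm: "\<And>j. j \<in> {1..CARD('d)} \<Longrightarrow> norm (p j) = 1"
    and eig: "\<And>j. j \<in> {1..CARD('d)} \<Longrightarrow> A *v p j = eigval A j *\<^sub>R p j"
    and anti: "\<And>j k. \<lbrakk>j \<in> {1..CARD('d)}; k \<in> {1..CARD('d)}; j \<le> k\<rbrakk> \<Longrightarrow> eigval A k \<le> eigval A j"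
    using symmetric_eigval_basis[OF A] by blast
  have quad: "quad_form A (p j) = eigval A j" if "j \<in> {1..CARD('d)}" for j
    using that norm eig by (intro quad_form_eigenvector)
  have J: "pairwise orthogonal (p ` J)" "\<And>v. v \<in> p ` J \<Longrightarrow> norm v = 1"
    "\<And>v. v \<in> p ` J \<Longrightarrow> A *v v = quad_form A v *\<^sub>R v"
    if "J \<subseteq> {1..CARD('d)}" for J
    using that norm eig quad by (auto simp: subset_iff intro: pairwise_subset[OF orth])
  have indep: "independent (p ` J)" if "J \<subseteq> {1..CARD('d)}" for J
    using J[OF that] by (intro orthonormal_imp_independent)
  have card: "card (p ` J) = card J" if "J \<subseteq> {1..CARD('d)}" for J
    using that inj by (intro card_image) (rule inj_on_subset)
  have lo: "{1..i} \<subseteq> {1..CARD('d)}" and hi: "{i..CARD('d)} \<subseteq> {1..CARD('d)}" using i by auto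
  show thesis
  proof (rule that[of "p ` {1..i}" "p ` {i..CARD('d)}"])
    show "independent (p ` {1..i})" "independent (p ` {i..CARD('d)})"
      by (rule indep[OF lo], rule indep[OF hi])
    show "card (p ` {1..i}) = i" "card (p ` {i..CARD('d)}) = Suc CARD('d) - i"
      by (simp_all only: card[OF lo] card[OF hi] card_atLeastAtMost diff_Suc_1)
    have le: "eigval A i \<le> eigval A j" if "j \<in> {1..i}" for j using i that by (intro anti) auto
    have ge: "eigval A j \<le> eigval A i" if "j \<in> {i..CARD('d)}" for j using i that by (intro anti) auto
    have "eigval A i \<le> quad_form A x" if "x \<in> span (p ` {1..i})" "norm x = 1" for x
      by (rule quad_form_span_bounds(1)[OF _ J[OF lo] that]) (use lo quad le in \<open>auto simp: subset_iff\<close>)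
    then show "\<forall>x\<in>span (p ` {1..i}). norm x = 1 \<longrightarrow> eigval A i \<le> quad_form A x" by blast
    have "quad_form A x \<le> eigval A i" if "x \<in> span (p ` {i..CARD('d)})" "norm x = 1" for x
      by (rule quad_form_span_bounds(2)[OF _ J[OF hi] that]) (use hi quad ge in \<open>auto simp: subset_iff\<close>)
    then show "\<forall>x\<in>span (p ` {i..CARD('d)}). norm x = 1 \<longrightarrow> quad_form A x \<le> eigval A i"
      by blast
    show "\<forall>v\<in>p ` {1..i}. \<exists>c\<ge>eigval A i. A *v v = c *\<^sub>R v"
      using eig le lo by blast
  qed
qed

text \<open>As \<open>Q\<close> and \<open>P\<close> agree on the eigenvectors of \<open>P\<close> with positive eigenvalue and
  \<open>Q \<le> P\<close> everywhere, the eigenvalues of \<open>P\<close> can be tested against the quadratic form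
  of \<open>Q\<close> itself. So the sharper bounds for \<open>Q\<close> apply, with constant 5 instead of 7.\<close>

lemma eigval_comparison_vectors:
  fixes G :: "real ^ 'd ^ 'd"
  assumes G: "symmetric_matrix G" and Q: "pos_neg_parts Q P N" and i: "i \<in> {1..CARD('d)}"
  obtains x y where "norm x = 1" "quad_form G x \<le> eigval G i"
      "eigval P i \<le> max 0 (quad_form Q x)"
    and "norm y = 1" "eigval G i \<le> quad_form G y" "quad_form Q y \<le> eigval P i"
proof -
  have P: "symmetric_matrix P" using Q by (simp add: pos_neg_parts_def pos_semidef_def)
  obtain S T where G: "independent S" "card S = i" "independent T" "card T = Suc CARD('d) - i"
    and G_lo: "\<forall>x\<in>span S. norm x = 1 \<longrightarrow> eigval G i \<le> quad_form G x"
    and G_hi: "\<forall>x\<in>span T. norm x = 1 \<longrightarrow> quad_form G x \<le> eigval G i"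
    by (rule eigval_subspaces[OF G i])
  obtain U V where P: "independent U" "card U = i" "independent V" "card V = Suc CARD('d) - i"
    and P_lo: "\<forall>x\<in>span U. norm x = 1 \<longrightarrow> eigval P i \<le> quad_form P x"
    and P_hi: "\<forall>x\<in>span V. norm x = 1 \<longrightarrow> quad_form P x \<le> eigval P i"
    and P_eig: "\<forall>v\<in>U. \<exists>c\<ge>eigval P i. P *v v = c *\<^sub>R v"
    by (rule eigval_subspaces[OF P i])
  have dims: "DIM(real ^ 'd) < card U + card T" "DIM(real ^ 'd) < card S + card V"
    using i by (simp_all add: P G)
  obtain x where x: "x \<in> span U" "x \<in> span T" "norm x = 1"
    by (rule spans_share_unit_vector[OF P(1) G(3) dims(1)])
  obtain y where y: "y \<in> span S" "y \<in> span V" "norm y = 1"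
    by (rule spans_share_unit_vector[OF G(1) P(3) dims(2)])
  have "eigval P i \<le> max 0 (quad_form Q x)"
  \<comment> \<open>A nonpositive eigenvalue is covered by the 0 in the maximum. Otherwise every
    vector of \<open>U\<close> has a positive eigenvalue, so \<open>N\<close> vanishes on
    \<open>U\<close> and, by linearity, on its span.\<close>
  proof (cases "0 < eigval P i")
    case True
    have "N *v v = 0" if v: "v \<in> U" for v
    proof -
      obtain c where "eigval P i \<le> c" "P *v v = c *\<^sub>R v" using P_eig v by blast
      then show ?thesis
        using True by (intro neg_part_annihilates_pos_eigenvector[OF Q, of v c]) auto
    qed
    then have "span U \<subseteq> {v. N *v v = 0}"
      by (intro span_minimal) (auto simp: subspace_def matrix_vector_right_distrib
          matrix_vector_mult_scaleR)
    then have "quad_form Q x = quad_form P x"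
      using Q x(1) by (auto simp: pos_neg_parts_def quad_form_def matrix_vector_mult_diff_rdistrib)
    then show ?thesis using P_lo x(1,3) by (simp add: le_max_iff_disj)
  qed auto
  moreover have "quad_form Q y \<le> eigval P i"
    using pos_neg_parts_quad_form_le[OF Q, of y] P_hi y(2,3) by fastforce
  ultimately show thesis
    using that[OF x(3) _ _ y(3)] G_hi G_lo x(2,3) y(1,3) by blast
qed

section \<open>Positive semidefiniteness and the Gram matrix\<close>

lemma eigval_nonneg:
  fixes A :: "real ^ 'd ^ 'd"
  assumes A: "pos_semidef A" and i: "i \<in> {1..CARD('d)}"
  shows "0 \<le> eigval A i"
proof -
  have "symmetric_matrix A" using A by (simp add: pos_semidef_def)
  then obtain p where "norm (p i) = 1" "A *v p i = eigval A i *\<^sub>R p i"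
    using symmetric_eigval_basis i by metis
  then show ?thesis using A quad_form_eigenvector by (metis pos_semidef_def)
qed

text \<open>In the integrable case the form at \<open>\<theta>\<close> is the second moment of
  \<open>\<theta> \<bullet> X\<close>.\<close>

lemma pos_semidef_gram:
  fixes X :: "'w \<Rightarrow> real ^ 'd"
  shows "pos_semidef (gram M X)"
proof (cases "integrable M (\<lambda>\<omega>. (\<chi> i j. X \<omega> $ i * X \<omega> $ j) :: real ^ 'd ^ 'd)")
  case True
  have entry: "gram M X $ i $ j = (\<integral>\<omega>. X \<omega> $ i * X \<omega> $ j \<partial>M)" for i j
    unfolding gram_def
    using integral_bounded_linear[OF bounded_linear_compose[OF bounded_linear_vec_nth[of j]
          bounded_linear_vec_nth[of i]] True] by simp
  have int: "integrable M (\<lambda>\<omega>. X \<omega> $ i * X \<omega> $ j)" for i j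
    using integrable_bounded_linear[OF bounded_linear_compose[OF bounded_linear_vec_nth[of j]
          bounded_linear_vec_nth[of i]] True] by simp
  have "quad_form (gram M X) \<theta> = (\<integral>\<omega>. (\<theta> \<bullet> X \<omega>)\<^sup>2 \<partial>M)" for \<theta>
  proof -
    have "quad_form (gram M X) \<theta>
        = (\<Sum>i\<in>UNIV. \<Sum>j\<in>UNIV. \<integral>\<omega>. \<theta> $ i * (X \<omega> $ i * X \<omega> $ j * \<theta> $ j) \<partial>M)"
      by (simp add: quad_form_def inner_vec_def matrix_vector_mult_def entry sum_distrib_left)
    also have "\<dots> = (\<integral>\<omega>. (\<Sum>i\<in>UNIV. \<Sum>j\<in>UNIV. \<theta> $ i * (X \<omega> $ i * X \<omega> $ j * \<theta> $ j)) \<partial>M)"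
      using int by (simp add: Bochner_Integration.integral_sum)
    also have "\<dots> = (\<integral>\<omega>. (\<theta> \<bullet> X \<omega>)\<^sup>2 \<partial>M)"
      by (simp add: inner_vec_def power2_eq_square sum_product ac_simps)
    finally show ?thesis .
  qed
  moreover have "transpose (gram M X) = gram M X"
    by (simp add: vec_eq_iff transpose_def entry mult.commute)
  ultimately show ?thesis by (simp add: pos_semidef_def symmetric_matrix_def)
next
  case False
  \<comment> \<open>The Bochner integral of a non-integrable function is 0 by convention, and the
    zero matrix is positive semidefinite.\<close>
  then have "gram M X = 0" by (simp add: gram_def not_integrable_integral_eq)
  moreover have "transpose (0 :: real ^ 'd ^ 'd) = 0" by (simp add: transpose_def vec_eq_iff)
  ultimately show ?thesis by (simp add: pos_semidef_def symmetric_matrix_def quad_form_def)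
qed

section \<open>Monotonicity of the error bound\<close>

lemma zeta_antimono:
  assumes "0 \<le> ln (of_int (K_const n a \<kappa>) / \<epsilon>)" "1 \<le> \<kappa>" "0 \<le> s" "0 < t" "t \<le> t'"
  shows "zeta n a \<epsilon> \<kappa> s t' \<le> zeta n a \<epsilon> \<kappa> s t"
proof -
  have c: "0 < c_const" by (simp add: c_const_def)
  show ?thesis
    unfolding zeta_def
    using assms c
    by (intro add_mono mult_right_mono mult_left_mono real_sqrt_le_mono divide_left_mono
        mult_nonneg_nonneg) (auto intro!: mult_pos_pos)
qed

lemma zeta_pos:
  assumes "0 \<le> ln (of_int (K_const n a \<kappa>) / \<epsilon>)" "1 \<le> \<kappa>" "0 < s" "0 < t"
  shows "0 < zeta n a \<epsilon> \<kappa> s t"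
proof -
  have c: "0 < c_const" by (simp add: c_const_def)
  show ?thesis
    unfolding zeta_def
    using assms c
    by (intro add_nonneg_pos mult_nonneg_nonneg mult_pos_pos) auto
qed

text \<open>The factor \<open>sqrt t\<close> cancels \<open>t\<close> in both denominators: the
  second root becomes constant, and the first gets a radicand that is affine in \<open>t\<close>
  with nonnegative slope. So \<open>zeta\<close> decreases no faster than
  \<open>1 / sqrt t\<close>.\<close>

lemma sqrt_mult_zeta_mono:
  assumes "0 \<le> ln (of_int (K_const n a \<kappa>) / \<epsilon>)" "1 \<le> \<kappa>" "0 \<le> s" "0 < t" "t \<le> t'"
  shows "sqrt t * zeta n a \<epsilon> \<kappa> s t \<le> sqrt t' * zeta n a \<epsilon> \<kappa> s t'"
proof -
  define L where "L = ln (of_int (K_const n a \<kappa>) / \<epsilon>)"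
  define \<alpha> where "\<alpha> = (2 + 3 * c_const) * s / (4 * (2 + c_const) * sqrt \<kappa>)"
  define \<beta> where "\<beta> = 2 * (2 + c_const) * sqrt \<kappa> * s"
  have eq: "sqrt x * zeta n a \<epsilon> \<kappa> s x
      = sqrt (2 * (\<kappa> - 1) * (\<alpha> + x * L)) * cosh (a / 4) + sqrt \<beta> * cosh (a / 2)"
    if "0 < x" for x
  proof -
    have "sqrt x * sqrt (2 * (\<kappa> - 1) * (\<alpha> / x + L)) = sqrt (2 * (\<kappa> - 1) * (\<alpha> + x * L))"
      using that by (simp add: real_sqrt_mult[symmetric] field_simps)
    moreover have "sqrt x * sqrt (\<beta> / x) = sqrt \<beta>"
      using that by (simp add: real_sqrt_mult[symmetric])
    moreover have "zeta n a \<epsilon> \<kappa> s x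
      = sqrt (2 * (\<kappa> - 1) * (\<alpha> / x + L)) * cosh (a / 4) + sqrt (\<beta> / x) * cosh (a / 2)"
      by (simp add: zeta_def \<alpha>_def \<beta>_def L_def)
    ultimately show ?thesis by (simp only: distrib_left mult.assoc[symmetric])
  qed
  show ?thesis
    using assms by (simp add: eq mult_right_mono mult_left_mono L_def)
qed

text \<open>\<open>K_const\<close> may be nonpositive; this case is harmless because \<open>ln\<close> is extended to the
  reals by \<open>ln (- x) = ln x\<close> and \<open>ln 0 = 0\<close>.\<close>

lemma ln_of_int_div_nonneg:
  assumes "0 < \<epsilon>" "\<epsilon> < 1"
  shows "0 \<le> ln (of_int k / \<epsilon> :: real)"
proof -
  have pos: "0 \<le> ln (of_int k / \<epsilon> :: real)" if "0 < k" for k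
    using assms that by (intro ln_ge_zero) (simp add: field_simps)
  consider "k = 0" | "0 < k" | "0 < - k" by linarith
  then show ?thesis
  proof cases
    case 3
    then show ?thesis using pos[OF 3] by (simp add: ln_minus)
  qed (use pos in auto)
qed

text \<open>The threshold 8 enters twice: it makes every branch of \<open>B_star\<close> finite, as
  \<open>6 + 1 / (\<kappa> - 1) \<le> 8\<close>, and it keeps \<open>z = \<zeta>(t) / \<surd>n\<close> in \<open>[0, 1/8]\<close>, where
  \<open>z (1 - 4 z)\<close> increases. As \<open>t z\<^sup>2\<close> increases with \<open>t\<close>, so does
  \<open>t z / (1 - 4 z) = t z\<^sup>2 / (z (1 - 4 z))\<close>.\<close>

lemma B_star_real:
  assumes \<epsilon>: "0 < \<epsilon>" "\<epsilon> < 1" and n: "0 < n" and \<kappa>: "3/2 \<le> \<kappa>" and \<sigma>: "0 < \<sigma>" and s: "0 < s"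
    and small: "8 * zeta n a \<epsilon> \<kappa> s \<sigma> \<le> sqrt (real n)"
  obtains b where "\<And>t. B_star n a \<epsilon> \<kappa> s \<sigma> t = ereal (b t)" "antimono b"
    "mono (\<lambda>t. max t \<sigma> * b t)" "\<And>t. 0 \<le> b t" "\<And>t. b t \<le> 1/4" "\<And>t. b (max t \<sigma>) = b t"
proof -
  define z where "z t = zeta n a \<epsilon> \<kappa> s (max t \<sigma>) / sqrt (real n)" for t
  have L: "0 \<le> ln (of_int (K_const n a \<kappa>) / \<epsilon>)" by (rule ln_of_int_div_nonneg[OF \<epsilon>])
  have \<kappa>1: "1 \<le> \<kappa>" using \<kappa> by simp
  have max_pos: "0 < max t \<sigma>" for t using \<sigma> by simp
  have z_pos: "0 < z t" for t
    unfolding z_def using n s by (intro divide_pos_pos zeta_pos[OF L \<kappa>1 _ max_pos]) auto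
  have z_anti: "z t' \<le> z t" if "t \<le> t'" for t t'
    unfolding z_def using n s that max_pos
    by (intro divide_right_mono zeta_antimono[OF L \<kappa>1]) auto
  have tz_mono: "max t \<sigma> * (z t)\<^sup>2 \<le> max t' \<sigma> * (z t')\<^sup>2" if "t \<le> t'" for t t'
  proof -
    have "sqrt (max t \<sigma>) * z t \<le> sqrt (max t' \<sigma>) * z t'"
      unfolding z_def times_divide_eq_right using s that max_pos
      by (intro divide_right_mono sqrt_mult_zeta_mono[OF L \<kappa>1]) auto
    then have "(sqrt (max t \<sigma>) * z t)\<^sup>2 \<le> (sqrt (max t' \<sigma>) * z t')\<^sup>2"
      using z_pos[of t] max_pos[of t] by (intro power_mono) auto
    then show ?thesis
      using max_pos[of t] max_pos[of t'] by (simp add: power_mult_distrib)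
  qed
  have z_le: "z t \<le> 1/8" for t
  proof -
    have "zeta n a \<epsilon> \<kappa> s (max t \<sigma>) \<le> zeta n a \<epsilon> \<kappa> s \<sigma>"
      using s \<sigma> by (intro zeta_antimono[OF L \<kappa>1]) auto
    then show ?thesis using small n by (simp add: z_def field_simps)
  qed
  define b where "b t = z t / (1 - 4 * z t)" for t
  have "B_star n a \<epsilon> \<kappa> s \<sigma> t = ereal (b t)" for t
  proof -
    have "6 + 1 / (\<kappa> - 1) \<le> 8" using \<kappa> by (simp add: field_simps)
    then have "(6 + 1 / (\<kappa> - 1)) * zeta n a \<epsilon> \<kappa> s (max t \<sigma>) \<le> 8 * zeta n a \<epsilon> \<kappa> s (max t \<sigma>)"
      using zeta_pos[OF L \<kappa>1 s max_pos, of t] by (intro mult_right_mono) auto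
    also have "\<dots> \<le> sqrt (real n)" using z_le[of t] n by (simp add: z_def field_simps)
    finally show ?thesis by (simp add: B_star_def b_def z_def)
  qed
  moreover have "antimono b"
    unfolding b_def
  proof (intro antimonoI frac_le)
    fix t t' :: real assume le: "t \<le> t'"
    show "0 < 1 - 4 * z t" "0 \<le> z t" using z_le[of t] z_pos[of t] by auto
    show "z t' \<le> z t" "1 - 4 * z t \<le> 1 - 4 * z t'" using z_anti[OF le] by auto
  qed
  moreover have "mono (\<lambda>t. max t \<sigma> * b t)"
  proof (rule monoI)
    fix t t' :: real assume le: "t \<le> t'"
    have eq: "max x \<sigma> * b x = (max x \<sigma> * (z x)\<^sup>2) / (z x * (1 - 4 * z x))" for x
      using z_pos[of x] by (simp add: b_def power2_eq_square)
    \<comment> \<open>The product is \<open>z t * (1 - 4 * z t) - z t' * (1 - 4 * z t')\<close>; its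
      second factor is nonnegative because both values of \<open>z\<close> are at most
      \<open>1/8\<close>.\<close>
    have "0 \<le> (z t - z t') * (1 - 4 * (z t + z t'))"
      using z_anti[OF le] z_le[of t] z_le[of t'] by (intro mult_nonneg_nonneg) auto
    then have "z t' * (1 - 4 * z t') \<le> z t * (1 - 4 * z t)" by (simp add: algebra_simps)
    moreover have "0 < z t' * (1 - 4 * z t')"
      using z_pos[of t'] z_le[of t'] by (intro mult_pos_pos) auto
    ultimately show "max t \<sigma> * b t \<le> max t' \<sigma> * b t'"
      unfolding eq using tz_mono[OF le] max_pos[of t'] by (intro frac_le) auto
  qed
  \<comment> \<open>With \<open>z t \<le> 1/8\<close> the numerator is at most \<open>1/8\<close>
    and the denominator at least \<open>1/2\<close>.\<close>
  moreover have "0 \<le> b t" "b t \<le> 1/4" for t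
    using z_pos[of t] z_le[of t] by (auto simp: b_def field_simps)
  moreover have "b (max t \<sigma>) = b t" for t by (simp add: b_def z_def)
  ultimately show thesis using that by blast
qed

section \<open>Transfer from quadratic forms to eigenvalues\<close>

text \<open>Here \<open>quad g q\<close> stands for a unit vector at which the two forms take the
  values \<open>g\<close> and \<open>q\<close>, and \<open>l\<close>, \<open>m\<close> are the
  eigenvalues to compare. The first pair bounds \<open>m\<close> from above, the second bounds
  \<open>l\<close>. An error term at a value below the wanted eigenvalue grows to the desired one
  (\<open>up\<close>, \<open>up_s\<close>); one at a value above it is first moved to the other side
  (\<open>down\<close>).\<close>

lemma threshold_transfer:
  fixes b :: "real \<Rightarrow> real" and quad :: "real \<Rightarrow> real \<Rightarrow> bool"
  assumes b: "antimono b" "mono (\<lambda>t. max t \<sigma> * b t)" "\<And>t. 0 \<le> b t" "\<And>t. b t \<le> 1/4"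
      "\<And>t. b (max t \<sigma>) = b t"
    and \<sigma>: "0 < \<sigma>" "\<sigma> \<le> s"
    and close1: "\<And>g q. quad g q \<Longrightarrow> \<bar>max q \<sigma> - max g \<sigma>\<bar> \<le> 2 * max g \<sigma> * b g + \<eta>"
    and close2: "\<And>g q. quad g q \<Longrightarrow> \<bar>max q \<sigma> - max g \<sigma>\<bar> \<le> 2 * max q \<sigma> * b (min q s) + \<eta>"
    and gq: "quad g q" "g \<le> l" "max m \<sigma> \<le> max q \<sigma>"
    and gq': "quad g' q'" "l \<le> g'" "q' \<le> m"
  shows "\<bar>max l \<sigma> - max m \<sigma>\<bar> \<le> 2 * max l \<sigma> * b l + \<eta>"
    and "\<bar>max l \<sigma> - max m \<sigma>\<bar> \<le> 2 * max m \<sigma> * b (min m s) + \<eta>"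
proof -
  have up: "2 * max x \<sigma> * b x \<le> 2 * max y \<sigma> * b y" if "x \<le> y" for x y
    using monoD[OF b(2) that] by simp
  \<comment> \<open>As \<open>\<sigma> \<le> s\<close>, truncation at \<open>s\<close> and
    thresholding at \<open>\<sigma>\<close> commute, and \<open>b\<close> ignores
    thresholding.\<close>
  have b_clamp: "b (min (max x \<sigma>) s) = b (min x s)" for x
  proof -
    have "min (max x \<sigma>) s = max (min x s) \<sigma>" using \<sigma> by (simp add: min_def max_def)
    then show ?thesis by (simp add: b(5))
  qed
  have up_s: "2 * max x \<sigma> * b (min x s) \<le> 2 * max y \<sigma> * b (min y s)" if "max x \<sigma> \<le> max y \<sigma>" for x y
  proof -
    \<comment> \<open>Up to \<open>s\<close> this is the monotonicity of the product; beyond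
      \<open>s\<close> the second factor is frozen at \<open>b s\<close> and only the first one
      grows. Arguments on both sides of \<open>s\<close> are compared through
      \<open>s\<close>.\<close>
    have mono: "max x \<sigma> * b (min x s) \<le> max y \<sigma> * b (min y s)" if "x \<le> y" for x y
    proof (cases "y \<le> s")
      case True
      then show ?thesis using up[OF that] that by (simp add: min_absorb1)
    next
      case False
      then have "max (min x s) \<sigma> * b (min x s) \<le> max s \<sigma> * b s"
        by (intro monoD[OF b(2)]) auto
      moreover have "max x \<sigma> * b s \<le> max y \<sigma> * b s"
        using that b(3) by (intro mult_right_mono) auto
      moreover have "max s \<sigma> * b s \<le> max y \<sigma> * b s"
        using False b(3) by (intro mult_right_mono) auto
      ultimately show ?thesis using False by (cases "x \<le> s") (auto simp: min_def)
    qed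
    then show ?thesis using mono[OF that] by (simp add: b_clamp)
  qed
  \<comment> \<open>Since \<open>b\<close> is at most \<open>1/4\<close>, the factors
    \<open>1 - 2 * b u\<close> and \<open>1 - 2 * b v\<close> are positive, so the products compare
    factor by factor.\<close>
  have down: "max x \<sigma> - 2 * max x \<sigma> * b u \<le> max y \<sigma> - 2 * max y \<sigma> * b v"
    if "max x \<sigma> \<le> max y \<sigma>" "b v \<le> b u" for x y u v
  proof -
    have "max x \<sigma> * (1 - 2 * b u) \<le> max y \<sigma> * (1 - 2 * b v)"
      using that b(4)[of u] \<sigma> by (intro mult_mono) auto
    then show ?thesis by (simp add: right_diff_distrib mult.assoc mult.left_commute)
  qed
  have order: "max g \<sigma> \<le> max l \<sigma>" "max l \<sigma> \<le> max g' \<sigma>" "max q' \<sigma> \<le> max m \<sigma>"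
    using gq(2) gq'(2,3) by auto
  \<comment> \<open>Only the thresholded values of \<open>m\<close> and \<open>q\<close> are known
    to be ordered, so antimonotonicity is applied to them and the thresholds are removed
    afterwards.\<close>
  have "b (min (max q \<sigma>) s) \<le> b (min (max m \<sigma>) s)"
    using gq(3) by (intro antimonoD[OF b(1)] min.mono) auto
  then have clamp_le: "b (min q s) \<le> b (min m s)" by (simp add: b_clamp)
  have "max l \<sigma> - max m \<sigma> \<le> 2 * max l \<sigma> * b l + \<eta>"
    using close1[OF gq'(1)] down[OF order(2) antimonoD[OF b(1) gq'(2)]] order(3) by linarith
  moreover have "max m \<sigma> - max l \<sigma> \<le> 2 * max l \<sigma> * b l + \<eta>"
    using close1[OF gq(1)] up[OF gq(2)] order(1) gq(3) by linarith
  ultimately show "\<bar>max l \<sigma> - max m \<sigma>\<bar> \<le> 2 * max l \<sigma> * b l + \<eta>" by linarith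
  have "max l \<sigma> - max m \<sigma> \<le> 2 * max m \<sigma> * b (min m s) + \<eta>"
    using close2[OF gq'(1)] up_s[OF order(3)] order(2,3) by linarith
  moreover have "max m \<sigma> - max l \<sigma> \<le> 2 * max m \<sigma> * b (min m s) + \<eta>"
    using close2[OF gq(1)] down[OF gq(3) clamp_le] order(1) by linarith
  ultimately show "\<bar>max l \<sigma> - max m \<sigma>\<bar> \<le> 2 * max m \<sigma> * b (min m s) + \<eta>" by linarith
qed

theorem proposition3p1:
  fixes M :: "'w measure"
    and X :: "'w \<Rightarrow> real ^ 'd"
    and Xs :: "nat \<Rightarrow> 'w \<Rightarrow> real ^ 'd"
    and n :: nat
    and a \<delta> \<epsilon> \<sigma> \<kappa> s :: real
    and G :: "real ^ 'd ^ 'd"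
    and Q Ghat Qneg :: "'w \<Rightarrow> real ^ 'd ^ 'd"
    and \<zeta> :: "real \<Rightarrow> real"
    and B :: "real \<Rightarrow> ereal"
  assumes "prob_space M"
    and "X \<in> borel_measurable M"
    and "integrable M (\<lambda>\<omega>. norm (X \<omega>) ^ 4)"
    and "0 < n"
    and "prob_space.indep_vars M (\<lambda>_. borel) Xs {1..n}"
    and "\<And>i. i \<in> {1..n} \<Longrightarrow> distr M borel (Xs i) = distr M borel X"
    and "0 < a" and "0 < \<delta>" and "0 < \<epsilon>" and "\<epsilon> < 1"
    and "G = gram M X"
    and "\<kappa> = kurtosis M X"
    and "s = s4_sq M X"
    and "\<zeta> = zeta n a \<epsilon> \<kappa> s"
    and "B = B_star n a \<epsilon> \<kappa> s \<sigma>"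
    and Q_sample: "\<exists>q \<in> borel_measurable (Pi\<^sub>M {1..n} (\<lambda>_. borel)).
           \<forall>\<omega>\<in>space M. Q \<omega> = q (\<lambda>i\<in>{1..n}. Xs i \<omega>)"
    and Q_symmetric: "\<And>\<omega>. \<omega> \<in> space M \<Longrightarrow> symmetric_matrix (Q \<omega>)"
    and Ghat: "\<And>\<omega>. \<omega> \<in> space M \<Longrightarrow> pos_neg_parts (Q \<omega>) (Ghat \<omega>) (Qneg \<omega>)"
    and Q_property:
      "\<lbrakk>8 * \<zeta> \<sigma> \<le> sqrt (real n); \<sigma> \<le> s; 3/2 \<le> \<kappa>\<rbrakk> \<Longrightarrow>
       \<exists>E\<in>sets M. measure M E \<ge> 1 - 2 * \<epsilon> \<and>
         (\<forall>\<omega>\<in>E. \<forall>\<theta>. norm \<theta> = 1 \<longrightarrow>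
            ereal \<bar>max (quad_form (Q \<omega>) \<theta>) \<sigma> - max (quad_form G \<theta>) \<sigma>\<bar>
              \<le> ereal (2 * max (quad_form G \<theta>) \<sigma>) * B (quad_form G \<theta>)
                + ereal (5 * \<delta> * frobenius_norm G) \<and>
            ereal \<bar>max (quad_form (Q \<omega>) \<theta>) \<sigma> - max (quad_form G \<theta>) \<sigma>\<bar>
              \<le> ereal (2 * max (quad_form (Q \<omega>) \<theta>) \<sigma>) * B (min (quad_form (Q \<omega>) \<theta>) s)
                + ereal (5 * \<delta> * frobenius_norm G) \<and>
            ereal \<bar>max (quad_form (Ghat \<omega>) \<theta>) \<sigma> - max (quad_form G \<theta>) \<sigma>\<bar>
              \<le> ereal (2 * max (quad_form G \<theta>) \<sigma>) * B (quad_form G \<theta>)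
                + ereal (7 * \<delta> * frobenius_norm G) \<and>
            ereal \<bar>max (quad_form (Ghat \<omega>) \<theta>) \<sigma> - max (quad_form G \<theta>) \<sigma>\<bar>
              \<le> ereal (2 * max (quad_form (Ghat \<omega>) \<theta>) \<sigma>) * B (min (quad_form (Ghat \<omega>) \<theta>) s)
                + ereal (7 * \<delta> * frobenius_norm G))"
    and "8 * \<zeta> \<sigma> \<le> sqrt (real n)"
    and "0 < \<sigma>" and "\<sigma> \<le> s"
    and "3/2 \<le> \<kappa>"
  shows "\<exists>E\<in>sets M. measure M E \<ge> 1 - 2 * \<epsilon> \<and>
         (\<forall>\<omega>\<in>E. \<forall>i\<in>{1..CARD('d)}.
            ereal \<bar>max (eigval G i) \<sigma> - max (eigval (Ghat \<omega>) i) \<sigma>\<bar>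
              \<le> ereal (2 * max (eigval G i) \<sigma>) * B (eigval G i)
                + ereal (5 * \<delta> * frobenius_norm G) \<and>
            ereal \<bar>max (eigval G i) \<sigma> - max (eigval (Ghat \<omega>) i) \<sigma>\<bar>
              \<le> ereal (2 * max (eigval (Ghat \<omega>) i) \<sigma>) * B (min (eigval (Ghat \<omega>) i) s)
                + ereal (5 * \<delta> * frobenius_norm G) \<and>
            ereal \<bar>eigval G i - eigval (Ghat \<omega>) i\<bar>
              \<le> ereal (2 * max (eigval G i) \<sigma>) * B (eigval G i)
                + ereal (5 * \<delta> * frobenius_norm G) + ereal \<sigma> \<and>
            ereal \<bar>eigval G i - eigval (Ghat \<omega>) i\<bar>
              \<le> ereal (2 * max (eigval (Ghat \<omega>) i) \<sigma>) * B (min (eigval (Ghat \<omega>) i) s)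
                + ereal (5 * \<delta> * frobenius_norm G) + ereal \<sigma>)"
proof -
  obtain E where E: "E \<in> sets M" "measure M E \<ge> 1 - 2 * \<epsilon>"
    and close: "\<And>\<omega> \<theta>. \<omega> \<in> E \<Longrightarrow> norm \<theta> = 1 \<Longrightarrow>
      ereal \<bar>max (quad_form (Q \<omega>) \<theta>) \<sigma> - max (quad_form G \<theta>) \<sigma>\<bar>
        \<le> ereal (2 * max (quad_form G \<theta>) \<sigma>) * B (quad_form G \<theta>)
          + ereal (5 * \<delta> * frobenius_norm G) \<and>
      ereal \<bar>max (quad_form (Q \<omega>) \<theta>) \<sigma> - max (quad_form G \<theta>) \<sigma>\<bar>
        \<le> ereal (2 * max (quad_form (Q \<omega>) \<theta>) \<sigma>) * B (min (quad_form (Q \<omega>) \<theta>) s)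
          + ereal (5 * \<delta> * frobenius_norm G)"
    using Q_property[OF \<open>8 * \<zeta> \<sigma> \<le> sqrt (real n)\<close> \<open>\<sigma> \<le> s\<close> \<open>3/2 \<le> \<kappa>\<close>] by blast
  have "0 < s" using \<open>0 < \<sigma>\<close> \<open>\<sigma> \<le> s\<close> by simp
  \<comment> \<open>The smallness assumption makes \<open>B\<close> finite everywhere, which reduces
    the claims to real inequalities.\<close>
  then obtain b where Bb: "\<And>t. B t = ereal (b t)"
    and b: "antimono b" "mono (\<lambda>t. max t \<sigma> * b t)" "\<And>t. 0 \<le> b t" "\<And>t. b t \<le> 1/4"
      "\<And>t. b (max t \<sigma>) = b t"
    unfolding \<open>B = B_star n a \<epsilon> \<kappa> s \<sigma>\<close>
    using B_star_real[OF \<open>0 < \<epsilon>\<close> \<open>\<epsilon> < 1\<close> \<open>0 < n\<close> \<open>3/2 \<le> \<kappa>\<close> \<open>0 < \<sigma>\<close>, of s a]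
      \<open>8 * \<zeta> \<sigma> \<le> sqrt (real n)\<close> \<open>\<zeta> = zeta n a \<epsilon> \<kappa> s\<close> by blast
  have G: "pos_semidef G" using pos_semidef_gram \<open>G = gram M X\<close> by simp
  define \<eta> where "\<eta> = 5 * \<delta> * frobenius_norm G"
  have main:
    "\<bar>max (eigval G i) \<sigma> - max (eigval (Ghat \<omega>) i) \<sigma>\<bar>
      \<le> 2 * max (eigval G i) \<sigma> * b (eigval G i) + \<eta>"
    "\<bar>max (eigval G i) \<sigma> - max (eigval (Ghat \<omega>) i) \<sigma>\<bar>
      \<le> 2 * max (eigval (Ghat \<omega>) i) \<sigma> * b (min (eigval (Ghat \<omega>) i) s) + \<eta>"
    "0 \<le> eigval (Ghat \<omega>) i" "0 \<le> eigval G i"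
    if \<omega>: "\<omega> \<in> E" and i: "i \<in> {1..CARD('d)}" for \<omega> i
  proof -
    have parts: "pos_neg_parts (Q \<omega>) (Ghat \<omega>) (Qneg \<omega>)"
      using Ghat \<omega> sets.sets_into_space[OF E(1)] by blast
    define quad where "quad g q \<longleftrightarrow>
      (\<exists>\<theta>. norm \<theta> = 1 \<and> g = quad_form G \<theta> \<and> q = quad_form (Q \<omega>) \<theta>)" for g q
    have c1: "\<bar>max q \<sigma> - max g \<sigma>\<bar> \<le> 2 * max g \<sigma> * b g + \<eta>"
      and c2: "\<bar>max q \<sigma> - max g \<sigma>\<bar> \<le> 2 * max q \<sigma> * b (min q s) + \<eta>" if "quad g q" for g q
      using that close[OF \<omega>] by (auto simp: quad_def Bb \<eta>_def)
    have sym: "symmetric_matrix G" using G by (simp add: pos_semidef_def)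
    obtain x y where x: "norm x = 1" "quad_form G x \<le> eigval G i"
        "eigval (Ghat \<omega>) i \<le> max 0 (quad_form (Q \<omega>) x)"
      and y: "norm y = 1" "eigval G i \<le> quad_form G y" "quad_form (Q \<omega>) y \<le> eigval (Ghat \<omega>) i"
      by (rule eigval_comparison_vectors[OF sym parts i])
    have xq: "quad (quad_form G x) (quad_form (Q \<omega>) x)" using x(1) by (auto simp: quad_def)
    have yq: "quad (quad_form G y) (quad_form (Q \<omega>) y)" using y(1) by (auto simp: quad_def)
    \<comment> \<open>The positive threshold absorbs the 0 in the maximum of
      \<open>x(3)\<close>.\<close>
    have "max (eigval (Ghat \<omega>) i) \<sigma> \<le> max (quad_form (Q \<omega>) x) \<sigma>"
      using x(3) \<open>0 < \<sigma>\<close> by (auto simp: max_def split: if_splits)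
    note tr = threshold_transfer[where quad = quad, OF b \<open>0 < \<sigma>\<close> \<open>\<sigma> \<le> s\<close> c1 c2 xq x(2) this yq y(2,3)]
    show "\<bar>max (eigval G i) \<sigma> - max (eigval (Ghat \<omega>) i) \<sigma>\<bar>
      \<le> 2 * max (eigval G i) \<sigma> * b (eigval G i) + \<eta>" by (rule tr(1))
    show "\<bar>max (eigval G i) \<sigma> - max (eigval (Ghat \<omega>) i) \<sigma>\<bar>
      \<le> 2 * max (eigval (Ghat \<omega>) i) \<sigma> * b (min (eigval (Ghat \<omega>) i) s) + \<eta>" by (rule tr(2))
    show "0 \<le> eigval (Ghat \<omega>) i"
      using parts i by (intro eigval_nonneg) (auto simp: pos_neg_parts_def)
    show "0 \<le> eigval G i" using G i by (rule eigval_nonneg)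
  qed
  \<comment> \<open>For \<open>l\<close> and \<open>m\<close> nonnegative, thresholding raises each
    by an amount in \<open>[0, \<sigma>]\<close>, so it changes their difference by at most
    \<open>\<sigma>\<close>, not \<open>2 * \<sigma>\<close>.\<close>
  have drop_max: "\<bar>l - m\<bar> \<le> c + \<sigma>" if "\<bar>max l \<sigma> - max m \<sigma>\<bar> \<le> c" "0 \<le> l" "0 \<le> m" for l m c :: real
    using that \<open>0 < \<sigma>\<close> by (auto simp: max_def abs_if split: if_splits)
  show ?thesis
  proof (intro bexI[OF _ E(1)] conjI[OF E(2)] ballI)
    fix \<omega> i assume "\<omega> \<in> E" "i \<in> {1..CARD('d)}"
    note m = main[OF this]
    show "ereal \<bar>max (eigval G i) \<sigma> - max (eigval (Ghat \<omega>) i) \<sigma>\<bar>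
              \<le> ereal (2 * max (eigval G i) \<sigma>) * B (eigval G i)
                + ereal (5 * \<delta> * frobenius_norm G) \<and>
            ereal \<bar>max (eigval G i) \<sigma> - max (eigval (Ghat \<omega>) i) \<sigma>\<bar>
              \<le> ereal (2 * max (eigval (Ghat \<omega>) i) \<sigma>) * B (min (eigval (Ghat \<omega>) i) s)
                + ereal (5 * \<delta> * frobenius_norm G) \<and>
            ereal \<bar>eigval G i - eigval (Ghat \<omega>) i\<bar>
              \<le> ereal (2 * max (eigval G i) \<sigma>) * B (eigval G i)
                + ereal (5 * \<delta> * frobenius_norm G) + ereal \<sigma> \<and>
            ereal \<bar>eigval G i - eigval (Ghat \<omega>) i\<bar>
              \<le> ereal (2 * max (eigval (Ghat \<omega>) i) \<sigma>) * B (min (eigval (Ghat \<omega>) i) s)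
                + ereal (5 * \<delta> * frobenius_norm G) + ereal \<sigma>"
      using m(1,2) drop_max[OF m(1,4,3)] drop_max[OF m(2,4,3)]
      unfolding Bb \<eta>_def[symmetric] times_ereal.simps plus_ereal.simps ereal_less_eq(3) by blast
  qed
qed

end
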